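(* Let $n\ge 0$, $d\ge 2$ be integers. For any tensor $T\in\mathrm{Sym}^d\mathbb{C}^{n+1}$ we have $\mathrm{Q}_s(T)\leq \mathrm{sgr}(T)$.
   Context: For $T=(t_{i_1,\dots,i_d})\in \mathrm{Sym}^d\mathbb{C}^{n+1}$ (coordinates with respect to the canonical basis $e_0,\dots,e_n$), the associated homogeneous degree $d$ polynomial is $F(x)=\sum t_{i_1,\dots,i_d}x_{i_1}\cdots x_{i_d}\in\mathbb{C}[x_0,\dots,x_n]_d$. The symmetric geometric rank is $\mathrm{sgr}(T)=\mathrm{codim}\{x\in\mathbb{C}^{n+1} : \frac{\partial F}{\partial x_0}(x)=\cdots=\frac{\partial F}{\partial x_n}(x)=0\}$ (codimension in $\mathbb{C}^{n+1}$); equivalently, it is the codimension in $\mathbb{P}^n$ of the singular locus of $F$, with the convention that the empty set has codimension $n+1$ in $\mathbb{P}^n$. For $A\in M_{n+1}(\mathbb{C})$ (not necessarily invertible), $A\cdot T:=\sum t_{i_1,\dots,i_d}\,Ae_{i_1}\otimes\cdots\otimes Ae_{i_d}$. Let $I_r=\sum_{i=0}^{r-1}e_i^{\otimes d}\in\mathrm{Sym}^d\mathbb{C}^{n+1}$ be the identity tensor with $r$ summands ($0\le r\le n+1$, $I_0=0$). The symmetric subrank of $T$ is $\mathrm{Q}_s(T)=\max\{r : A\cdot T=I_r\text{ for some }A\in M_{n+1}(\mathbb{C})\}$. *)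

theory Defs
  imports
    "HOL-Analysis.Derivative"
    "HOL-Combinatorics.Permutations"
    "HOL-Library.Extended_Nat"
    "Jordan_Normal_Form.Matrix"
begin

unbundle no vec_syntax

text \<open>
  Throughout, \<open>N\<close> is the dimension of the ambient space, i.e. the vectors are the elements of
  \<open>carrier_vec N\<close>, with coordinates and canonical basis \<open>unit_vec N i\<close> indexed by \<open>i < N\<close>.
\<close>

section \<open>Tensors\<close>

definition multi_indices :: "nat \<Rightarrow> nat \<Rightarrow> nat list set" where
  "multi_indices N d = {is. length is = d \<and> set is \<subseteq> {..<N}}"

text \<open>
  A tensor of order \<open>d\<close> over \<open>\<complex>\<^sup>N\<close> is given by its coordinates with respect to the canonical basis.
  Coordinate families are extended by \<open>0\<close> outside \<open>multi_indices N d\<close>, so that equality of tensors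
  is equality of functions.
\<close>

type_synonym tensor = "nat list \<Rightarrow> complex"

definition sym_tensors :: "nat \<Rightarrow> nat \<Rightarrow> tensor set" where
  "sym_tensors N d =
     {T. (\<forall>is. is \<notin> multi_indices N d \<longrightarrow> T is = 0) \<and>
         (\<forall>is \<in> multi_indices N d. \<forall>\<pi>. \<pi> permutes {..<d} \<longrightarrow> T (permute_list \<pi> is) = T is)}"

text \<open>The elementary tensor \<open>v\<^sub>1 \<otimes> \<dots> \<otimes> v\<^sub>d\<close> for \<open>vs = [v\<^sub>1, \<dots>, v\<^sub>d]\<close>.\<close>

definition elem_tensor :: "nat \<Rightarrow> complex vec list \<Rightarrow> tensor" where
  "elem_tensor N vs =
     (\<lambda>js. if js \<in> multi_indices N (length vs)
           then \<Prod>k<length vs. (vs ! k) $ (js ! k) else 0)"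

text \<open>\<open>A \<cdot> T = \<Sum> t\<^bsub>i\<^sub>1\<dots>i\<^sub>d\<^esub> A e\<^bsub>i\<^sub>1\<^esub> \<otimes> \<dots> \<otimes> A e\<^bsub>i\<^sub>d\<^esub>\<close>\<close>

definition tensor_act :: "nat \<Rightarrow> nat \<Rightarrow> complex mat \<Rightarrow> tensor \<Rightarrow> tensor" where
  "tensor_act N d A T =
     (\<lambda>js. \<Sum>is\<in>multi_indices N d.
             T is * elem_tensor N (map (\<lambda>i. A *\<^sub>v unit_vec N i) is) js)"

definition identity_tensor :: "nat \<Rightarrow> nat \<Rightarrow> nat \<Rightarrow> tensor" where
  "identity_tensor N d r = (\<lambda>js. \<Sum>i<r. elem_tensor N (replicate d (unit_vec N i)) js)"

text \<open>For \<open>d \<ge> 1\<close> the set below contains \<open>0\<close> (take \<open>A = 0\<close>), so the maximum exists.\<close>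

definition sym_subrank :: "nat \<Rightarrow> nat \<Rightarrow> tensor \<Rightarrow> nat" where
  "sym_subrank N d T =
     Max {r. r \<le> N \<and> (\<exists>A \<in> carrier_mat N N. tensor_act N d A T = identity_tensor N d r)}"


section \<open>Dimension of subsets of affine space\<close>

inductive_set poly_funs :: "nat \<Rightarrow> (complex vec \<Rightarrow> complex) set" for N :: nat where
  const: "(\<lambda>x. c) \<in> poly_funs N"
| coord: "i < N \<Longrightarrow> (\<lambda>x. x $ i) \<in> poly_funs N"
| add: "p \<in> poly_funs N \<Longrightarrow> q \<in> poly_funs N \<Longrightarrow> (\<lambda>x. p x + q x) \<in> poly_funs N"
| mult: "p \<in> poly_funs N \<Longrightarrow> q \<in> poly_funs N \<Longrightarrow> (\<lambda>x. p x * q x) \<in> poly_funs N"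

definition zariski_closed :: "nat \<Rightarrow> complex vec set \<Rightarrow> bool" where
  "zariski_closed N S \<longleftrightarrow>
     (\<exists>P \<subseteq> poly_funs N. S = {x \<in> carrier_vec N. \<forall>p\<in>P. p x = 0})"

definition irreducible_closed :: "nat \<Rightarrow> complex vec set \<Rightarrow> bool" where
  "irreducible_closed N S \<longleftrightarrow> zariski_closed N S \<and> S \<noteq> {} \<and>
     (\<forall>U V. zariski_closed N U \<longrightarrow> zariski_closed N V \<longrightarrow> S = U \<union> V \<longrightarrow> S = U \<or> S = V)"

text \<open>
  The Krull dimension of a Zariski closed set \<open>Z\<close>: the supremum of the lengths \<open>k\<close> of chains
  \<open>C\<^sub>0 \<subset> C\<^sub>1 \<subset> \<dots> \<subset> C\<^sub>k\<close> of irreducible closed subsets of \<open>Z\<close>.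
\<close>

definition zariski_dim :: "nat \<Rightarrow> complex vec set \<Rightarrow> enat" where
  "zariski_dim N Z =
     Sup {enat k | k. \<exists>C. (\<forall>i\<le>k. irreducible_closed N (C i) \<and> C i \<subseteq> Z) \<and>
                          (\<forall>i<k. C i \<subset> C (Suc i))}"

text \<open>
  The codimension in \<open>\<complex>\<^sup>N\<close> of a nonempty closed set. Since the dimension of such a set is
  at most \<open>N\<close>, the subtraction is not truncated.
\<close>

definition zariski_codim :: "nat \<Rightarrow> complex vec set \<Rightarrow> enat" where
  "zariski_codim N Z = enat N - zariski_dim N Z"


section \<open>Symmetric geometric rank\<close>

definition assoc_poly :: "nat \<Rightarrow> nat \<Rightarrow> tensor \<Rightarrow> complex vec \<Rightarrow> complex" where
  "assoc_poly N d T x = (\<Sum>is\<in>multi_indices N d. T is * (\<Prod>k<d. x $ (is ! k)))"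

definition partial_deriv :: "nat \<Rightarrow> nat \<Rightarrow> (complex vec \<Rightarrow> complex) \<Rightarrow> complex vec \<Rightarrow> complex" where
  "partial_deriv N i f x = deriv (\<lambda>t. f (x + t \<cdot>\<^sub>v unit_vec N i)) 0"

text \<open>
  For \<open>d \<ge> 2\<close> the critical locus contains \<open>0\<close>, so it is nonempty.
\<close>

definition sym_geometric_rank :: "nat \<Rightarrow> nat \<Rightarrow> tensor \<Rightarrow> enat" where
  "sym_geometric_rank N d T =
     zariski_codim N {x \<in> carrier_vec N. \<forall>i<N. partial_deriv N i (assoc_poly N d T) x = 0}"

end

theory Submission
  imports Defs
begin

text \<open>
  Write \<open>F\<close> for the form of \<open>T\<close>, \<open>Z\<close> for its critical locus in \<open>\<complex>\<^sup>N\<close>, \<open>N = n + 1\<close>, and let \<open>A \<cdot> T\<close> be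
  the identity tensor with \<open>r\<close> summands. With \<open>B\<close> the transpose of \<open>A\<close>, the polynomial \<open>F(B w)\<close> is
  \<open>w\<^sub>0\<^sup>d + \<dots> + w\<^bsub>r-1\<^esub>\<^sup>d\<close> for \<open>w\<close> in \<open>\<complex>\<^sup>r\<close>. Its only critical point is \<open>0\<close>, so that
  \<open>B w\<close> with \<open>w \<noteq> 0\<close> is never in the cone \<open>Z\<close>, and the claim is that this forces \<open>dim Z + r \<le> N\<close>.
  Geometrically, the map \<open>(p, w) \<mapsto> p - B w\<close> from \<open>Z \<times> \<complex>\<^sup>r\<close> to \<open>\<complex>\<^sup>N\<close> is finite.

  Dimension theory is replaced by counting functions. Put \<open>u = p - B w\<close>. The derivative of \<open>F\<close> in the
  direction of column \<open>i\<close> of \<open>B\<close> is zero at \<open>p = u + B w\<close>, and it is \<open>d * w\<^sub>i\<^bsup>d-1\<^esup>\<close> at \<open>B w\<close>. The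
  difference of the two is a polynomial all of whose terms contain a coordinate of \<open>u\<close>. Thus
  \<open>w\<^sub>i\<^bsup>d-1\<^esup>\<close> can be rewritten without raising the total degree and with a lower degree in \<open>w\<close>, and
  polynomial functions of degree at most \<open>s\<close> on \<open>Z \<times> \<complex>\<^sup>r\<close> are spanned by at most
  \<open>(s + 1)\<^sup>N * (d - 1)\<^sup>r\<close> monomials (\<open>reduced_bimonomials_span\<close>).

  On the other hand let \<open>C\<^sub>0 \<subset> \<dots> \<subset> C\<^sub>k\<close> be a chain of irreducible closed subsets of \<open>Z\<close>. Polynomials
  that vanish on \<open>C\<^sub>i\<close> but not on \<open>C\<^bsub>i+1\<^esub>\<close>, together with the coordinates of \<open>w\<close>, are \<open>k + r\<close>
  algebraically independent functions on \<open>C\<^sub>k \<times> \<complex>\<^sup>r\<close> (\<open>monomials_independent_along_flag\<close>). They have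
  \<open>(t + 1)\<^bsup>k+r\<^esup>\<close> linearly independent monomials with exponents at most \<open>t\<close>, of degree \<open>O(t)\<close>. Hence
  \<open>k + r \<le> N\<close> (\<open>critical_chain_length_bound\<close>).
\<close>

section \<open>Underdetermined linear systems\<close>

lemma underdetermined_system_nontrivial_solution:
  fixes C :: "'i \<Rightarrow> 'j \<Rightarrow> 'a::field"
  assumes "finite J" "finite I" "card J < card I"
  shows "\<exists>a. (\<exists>i\<in>I. a i \<noteq> 0) \<and> (\<forall>j\<in>J. (\<Sum>i\<in>I. a i * C i j) = 0)"
  using assms
proof (induction J arbitrary: I C rule: finite_induct)
  case empty
  then have "I \<noteq> {}" by auto
  then show ?case by (intro exI[of _ "\<lambda>_. 1"]) auto
next
  case (insert j J)
  show ?case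
  proof (cases "\<forall>i\<in>I. C i j = 0")
    case True
    have "card J < card I" using insert by simp
    from insert.IH[OF insert.prems(1) this, of C] True show ?thesis by auto
  next
    case False
    then obtain i0 where i0: "i0 \<in> I" "C i0 j \<noteq> 0" by auto
    \<comment> \<open>Gaussian elimination: \<open>i0\<close> is the pivot for equation \<open>j\<close>.\<close>
    define C' where "C' i l = C i l - (C i j / C i0 j) * C i0 l" for i l
    have "card J < card (I - {i0})" using insert i0 by simp
    from insert.IH[OF _ this, of C'] insert.prems(1)
    obtain a where a: "\<exists>i\<in>I - {i0}. a i \<noteq> 0"
      and z: "\<And>l. l \<in> J \<Longrightarrow> (\<Sum>i\<in>I - {i0}. a i * C' i l) = 0"
      by auto
    define a0 where "a0 = - (\<Sum>i\<in>I - {i0}. a i * (C i j / C i0 j))"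
    define b where "b = a(i0 := a0)"
    have split: "(\<Sum>i\<in>I. b i * C i l) = a0 * C i0 l + (\<Sum>i\<in>I - {i0}. a i * C i l)" for l
    proof -
      have "(\<Sum>i\<in>I. b i * C i l) = b i0 * C i0 l + (\<Sum>i\<in>I - {i0}. b i * C i l)"
        using insert.prems(1) i0(1) by (rule sum.remove)
      also have "(\<Sum>i\<in>I - {i0}. b i * C i l) = (\<Sum>i\<in>I - {i0}. a i * C i l)"
        by (intro sum.cong) (auto simp: b_def)
      finally show ?thesis by (simp add: b_def)
    qed
    have elim: "(\<Sum>i\<in>I. b i * C i l) = (\<Sum>i\<in>I - {i0}. a i * C' i l)" for l
      unfolding split a0_def C'_def
      by (simp add: sum_distrib_right sum_distrib_left sum_subtractf algebra_simps)
    have "C' i j = 0" for i using i0(2) by (simp add: C'_def)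
    then have "(\<Sum>i\<in>I. b i * C i j) = 0" by (simp add: elim)
    moreover have "\<exists>i\<in>I. b i \<noteq> 0" using a by (auto simp: b_def)
    ultimately show ?thesis using z elim by (intro exI[of _ b]) auto
  qed
qed

section \<open>Algebraic independence along a flag of sets\<close>

lemma sum_PiE_lessThan_Suc:
  fixes g :: "(nat \<Rightarrow> 'b) \<Rightarrow> 'c::comm_monoid_add"
  shows "(\<Sum>a\<in>PiE {..<Suc K} (\<lambda>_. B). g a)
    = (\<Sum>e\<in>B. \<Sum>a\<in>PiE {..<K} (\<lambda>_. B). g (a(K := e)))"
proof -
  have inj: "inj_on (\<lambda>(y, a). a(K := y)) (B \<times> PiE {..<K} (\<lambda>_. B))"
    using inj_combinator[of K "{..<K}" "\<lambda>_. B"] by simp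
  have "(\<Sum>a\<in>PiE {..<Suc K} (\<lambda>_. B). g a)
      = (\<Sum>p\<in>B \<times> PiE {..<K} (\<lambda>_. B). g ((\<lambda>(y, a). a(K := y)) p))"
    unfolding lessThan_Suc PiE_insert_eq
    using sum.reindex[OF inj, of g] by (simp add: o_def)
  also have "\<dots> = (\<Sum>e\<in>B. \<Sum>a\<in>PiE {..<K} (\<lambda>_. B). g (a(K := e)))"
    by (simp add: sum.cartesian_product case_prod_unfold)
  finally show ?thesis .
qed

text \<open>
  Each \<open>f i\<close> vanishes on one member of the flag \<open>X 0 \<subseteq> \<dots> \<subseteq> X K\<close> and may be cancelled on the
  next one. In a relation on \<open>X (Suc k)\<close>, ordered by powers of \<open>f k\<close>, the lowest power can therefore
  be cancelled; restricting what remains to \<open>X k\<close>, where \<open>f k\<close> is zero, leaves a relation between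
  \<open>f 0, \<dots>, f (k - 1)\<close> alone, to which induction applies. The set \<open>\<P>\<close> is an algebra of functions
  that delimits the factors for which the cancellation law has to be known.
\<close>

lemma monomials_independent_along_flag:
  fixes X :: "nat \<Rightarrow> 'a set" and f :: "nat \<Rightarrow> 'a \<Rightarrow> complex"
    and \<P> :: "('a \<Rightarrow> complex) set"
  assumes const: "\<And>c. (\<lambda>_. c) \<in> \<P>"
    and add: "\<And>p q. p \<in> \<P> \<Longrightarrow> q \<in> \<P> \<Longrightarrow> (\<lambda>x. p x + q x) \<in> \<P>"
    and mult: "\<And>p q. p \<in> \<P> \<Longrightarrow> q \<in> \<P> \<Longrightarrow> (\<lambda>x. p x * q x) \<in> \<P>"
    and f: "\<And>i. i < K \<Longrightarrow> f i \<in> \<P>"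
    and nonempty: "X 0 \<noteq> {}"
    and nested: "\<And>i. i < K \<Longrightarrow> X i \<subseteq> X (Suc i)"
    and vanish: "\<And>i x. i < K \<Longrightarrow> x \<in> X i \<Longrightarrow> f i x = 0"
    and cancel: "\<And>i q. i < K \<Longrightarrow> q \<in> \<P> \<Longrightarrow> \<forall>x\<in>X (Suc i). f i x * q x = 0
                  \<Longrightarrow> \<forall>x\<in>X (Suc i). q x = 0"
    and zero: "\<forall>x\<in>X K. (\<Sum>a\<in>PiE {..<K} (\<lambda>_. {..t}). c a * (\<Prod>i<K. f i x ^ a i)) = 0"
    and a: "a \<in> PiE {..<K} (\<lambda>_. {..t})"
  shows "c a = 0"
proof -
  have sum_P: "(\<lambda>x. \<Sum>i\<in>I. g i x) \<in> \<P>" if "\<And>i. i \<in> I \<Longrightarrow> g i \<in> \<P>"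
    for I :: "'i set" and g :: "'i \<Rightarrow> 'a \<Rightarrow> complex"
    using that by (induction I rule: infinite_finite_induct) (auto intro: const add)
  have prod_P: "(\<lambda>x. \<Prod>i\<in>I. g i x) \<in> \<P>" if "\<And>i. i \<in> I \<Longrightarrow> g i \<in> \<P>"
    for I :: "'i set" and g :: "'i \<Rightarrow> 'a \<Rightarrow> complex"
    using that by (induction I rule: infinite_finite_induct) (auto intro: const mult)
  have pow_P: "(\<lambda>x. g x ^ e) \<in> \<P>" if "g \<in> \<P>" for g e
    using that by (induction e) (auto intro: const mult)
  have "k \<le> K \<Longrightarrow>
      \<forall>x\<in>X k. (\<Sum>a\<in>PiE {..<k} (\<lambda>_. {..t}). c a * (\<Prod>i<k. f i x ^ a i)) = 0 \<Longrightarrow>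
      a \<in> PiE {..<k} (\<lambda>_. {..t}) \<Longrightarrow> c a = 0" for k c a
  proof (induction k arbitrary: c a)
    case 0
    then show ?case using nonempty by auto
  next
    case (Suc k)
    then have k: "k < K" by simp
    define Q where "Q e x = (\<Sum>a\<in>PiE {..<k} (\<lambda>_. {..t}). c (a(k := e)) * (\<Prod>i<k. f i x ^ a i))"
      for e x
    have Q_P: "Q e \<in> \<P>" for e
      unfolding Q_def using k by (intro sum_P mult const prod_P pow_P f) auto
    have expand: "(\<Sum>e\<le>t. f k x ^ e * Q e x) = 0" if "x \<in> X (Suc k)" for x
    proof -
      have "(\<Sum>e\<le>t. f k x ^ e * Q e x)
          = (\<Sum>a\<in>PiE {..<Suc k} (\<lambda>_. {..t}). c a * (\<Prod>i<Suc k. f i x ^ a i))"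
        unfolding sum_PiE_lessThan_Suc Q_def sum_distrib_left
      proof (intro sum.cong refl)
        fix e a
        have "(\<Prod>i<k. f i x ^ (a(k := e)) i) = (\<Prod>i<k. f i x ^ a i)"
          by (intro prod.cong) auto
        then show "f k x ^ e * (c (a(k := e)) * (\<Prod>i<k. f i x ^ a i))
            = c (a(k := e)) * (\<Prod>i<Suc k. f i x ^ (a(k := e)) i)"
          by simp
      qed
      also have "\<dots> = 0" using Suc.prems(2) that by blast
      finally show ?thesis .
    qed
    have coeffs: "e \<le> t \<Longrightarrow> b \<in> PiE {..<k} (\<lambda>_. {..t}) \<Longrightarrow> c (b(k := e)) = 0" for e b
    proof (induction e arbitrary: b rule: less_induct)
      case (less e)
      \<comment> \<open>The relation divided by \<open>f k ^ e\<close>; its lower coefficients vanish by induction on \<open>e\<close>.\<close>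
      define q where "q x = (\<Sum>e'=e..t. f k x ^ (e' - e) * Q e' x)" for x
      have q_P: "q \<in> \<P>"
        unfolding q_def using k by (intro sum_P mult pow_P f Q_P) auto
      have fq: "f k x ^ e * q x = 0" if "x \<in> X (Suc k)" for x
      proof -
        have low: "Q e' x = 0" if "e' < e" for e'
          unfolding Q_def
        proof (intro sum.neutral ballI)
          fix b' assume "b' \<in> PiE {..<k} (\<lambda>_. {..t})"
          with less.IH[OF that, of b'] less.prems(1) that have "c (b'(k := e')) = 0"
            by (meson less_imp_le order.trans)
          then show "c (b'(k := e')) * (\<Prod>i<k. f i x ^ b' i) = 0" by simp
        qed
        have "f k x ^ e * q x = (\<Sum>e'=e..t. f k x ^ e' * Q e' x)"
          unfolding q_def sum_distrib_left
          by (intro sum.cong refl) (simp add: power_add[symmetric] mult.assoc[symmetric])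
        also have "\<dots> = (\<Sum>e'\<le>t. f k x ^ e' * Q e' x)"
          by (intro sum.mono_neutral_left) (auto simp: low)
        finally show ?thesis using expand[OF that] by simp
      qed
      have "\<forall>x\<in>X (Suc k). f k x ^ j * q x = 0 \<Longrightarrow> \<forall>x\<in>X (Suc k). q x = 0" for j
      proof (induction j)
        case (Suc j)
        have "(\<lambda>x. f k x ^ j * q x) \<in> \<P>" using k by (intro mult pow_P f q_P)
        from cancel[OF k this] Suc.prems have "\<forall>x\<in>X (Suc k). f k x ^ j * q x = 0"
          by (simp add: mult.assoc)
        then show ?case by (rule Suc.IH)
      qed simp
      then have q0: "\<forall>x\<in>X (Suc k). q x = 0" using fq by blast
      have "Q e x = 0" if "x \<in> X k" for x
      proof -
        have "q x = (\<Sum>e'\<in>{e}. f k x ^ (e' - e) * Q e' x)"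
          unfolding q_def using less.prems(1) vanish[OF k that]
          by (intro sum.mono_neutral_right) auto
        then show ?thesis using q0 nested[OF k] that by auto
      qed
      then have "\<forall>x\<in>X k. (\<Sum>a\<in>PiE {..<k} (\<lambda>_. {..t}). c (a(k := e)) * (\<Prod>i<k. f i x ^ a i)) = 0"
        unfolding Q_def by blast
      from Suc.IH[OF _ this less.prems(2)] k show ?case by simp
    qed
    have "restrict a {..<k} \<in> PiE {..<k} (\<lambda>_. {..t})" "a k \<le> t"
      using Suc.prems(3) by (auto simp: PiE_def Pi_def)
    moreover have "(restrict a {..<k})(k := a k) = a"
      using Suc.prems(3) by (auto simp: PiE_def extensional_def fun_eq_iff)
    ultimately show ?case using coeffs by metis
  qed
  from this[OF order_refl zero a] show ?thesis .
qed

section \<open>Polynomials graded by total degree and degree in one group of variables\<close>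

text \<open>
  \<open>bideg_poly N r u w m l f\<close>: the function \<open>f\<close> is a polynomial in the functions \<open>u j\<close> (\<open>j < N\<close>) and
  \<open>w i\<close> (\<open>i < r\<close>) of total degree at most \<open>m\<close> and of degree at most \<open>l\<close> in the \<open>w i\<close>. Both degrees
  are needed: rewriting powers of the \<open>w i\<close> must keep the total degree, which controls the final count,
  and terminates because the degree in the \<open>w i\<close> drops.
\<close>

inductive bideg_poly ::
  "nat \<Rightarrow> nat \<Rightarrow> (nat \<Rightarrow> 'a \<Rightarrow> complex) \<Rightarrow> (nat \<Rightarrow> 'a \<Rightarrow> complex) \<Rightarrow> nat \<Rightarrow> nat \<Rightarrow> ('a \<Rightarrow> complex) \<Rightarrow> bool"
  for N r u w where
  const: "bideg_poly N r u w 0 0 (\<lambda>_. c)"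
| gen_u: "j < N \<Longrightarrow> bideg_poly N r u w 1 0 (u j)"
| gen_w: "i < r \<Longrightarrow> bideg_poly N r u w 1 1 (w i)"
| add: "bideg_poly N r u w m l f \<Longrightarrow> bideg_poly N r u w m l g \<Longrightarrow> bideg_poly N r u w m l (\<lambda>x. f x + g x)"
| mult: "bideg_poly N r u w m l f \<Longrightarrow> bideg_poly N r u w m' l' g
    \<Longrightarrow> bideg_poly N r u w (m + m') (l + l') (\<lambda>x. f x * g x)"
| weaken: "bideg_poly N r u w m l f \<Longrightarrow> m \<le> m' \<Longrightarrow> l \<le> l' \<Longrightarrow> bideg_poly N r u w m' l' f"

lemma bideg_poly_const: "bideg_poly N r u w m l (\<lambda>_. c)"
  by (rule bideg_poly.weaken[OF bideg_poly.const]) auto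

lemma bideg_poly_scale:
  "bideg_poly N r u w m l f \<Longrightarrow> bideg_poly N r u w m l (\<lambda>x. c * f x)"
  using bideg_poly.mult[OF bideg_poly.const[of N r u w c]] by fastforce

lemma bideg_poly_sum:
  "(\<And>i. i \<in> I \<Longrightarrow> bideg_poly N r u w m l (f i)) \<Longrightarrow> bideg_poly N r u w m l (\<lambda>x. \<Sum>i\<in>I. f i x)"
  by (induction I rule: infinite_finite_induct) (auto intro: bideg_poly_const bideg_poly.add)

lemma bideg_poly_prod:
  "(\<And>i. i \<in> I \<Longrightarrow> bideg_poly N r u w (m i) (l i) (f i))
    \<Longrightarrow> bideg_poly N r u w (\<Sum>i\<in>I. m i) (\<Sum>i\<in>I. l i) (\<lambda>x. \<Prod>i\<in>I. f i x)"
  by (induction I rule: infinite_finite_induct) (auto intro: bideg_poly_const bideg_poly.mult)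

lemma bideg_poly_power:
  "bideg_poly N r u w m l f \<Longrightarrow> bideg_poly N r u w (e * m) (e * l) (\<lambda>x. f x ^ e)"
  using bideg_poly_prod[of "{..<e}" N r u w "\<lambda>_. m" "\<lambda>_. l" "\<lambda>_. f"] by simp

text \<open>
  Every term in the expansion of the difference contains a factor \<open>\<alpha> k\<close>, which has degree \<open>0\<close> in the
  \<open>w\<close> variables.
\<close>

lemma bideg_poly_prod_add_minus_prod:
  assumes "finite K" "K \<noteq> {}"
    and "\<And>k. k \<in> K \<Longrightarrow> bideg_poly N r u w 1 0 (\<alpha> k)"
    and "\<And>k. k \<in> K \<Longrightarrow> bideg_poly N r u w 1 1 (\<beta> k)"
  shows "bideg_poly N r u w (card K) (card K - 1) (\<lambda>x. (\<Prod>k\<in>K. \<alpha> k x + \<beta> k x) - (\<Prod>k\<in>K. \<beta> k x))"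
  using assms
proof (induction K rule: finite_ne_induct)
  case (singleton k)
  then show ?case by simp
next
  case (insert k K)
  define P where "P x = (\<Prod>k\<in>K. \<alpha> k x + \<beta> k x)" for x
  define Q where "Q x = (\<Prod>k\<in>K. \<beta> k x)" for x
  have K: "0 < card K" using insert.hyps by (simp add: card_gt_0_iff)
  have "bideg_poly N r u w (\<Sum>k\<in>K. 1) (\<Sum>k\<in>K. 1) P"
    unfolding P_def using insert.prems
    by (intro bideg_poly_prod bideg_poly.add) (auto intro: bideg_poly.weaken)
  then have "bideg_poly N r u w (1 + card K) (0 + card K) (\<lambda>x. \<alpha> k x * P x)"
    using insert.prems by (intro bideg_poly.mult) auto
  moreover have "bideg_poly N r u w (1 + card K) (1 + (card K - 1)) (\<lambda>x. \<beta> k x * (P x - Q x))"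
    unfolding P_def Q_def using insert by (intro bideg_poly.mult) auto
  ultimately have "bideg_poly N r u w (1 + card K) (card K) (\<lambda>x. \<alpha> k x * P x + \<beta> k x * (P x - Q x))"
    using K by (intro bideg_poly.add) simp_all
  moreover have "(\<lambda>x. \<alpha> k x * P x + \<beta> k x * (P x - Q x))
      = (\<lambda>x. (\<Prod>k\<in>insert k K. \<alpha> k x + \<beta> k x) - (\<Prod>k\<in>insert k K. \<beta> k x))"
    using insert.hyps by (simp add: P_def Q_def algebra_simps)
  ultimately show ?case using insert.hyps by simp
qed

lemma poly_funs_bideg_poly:
  assumes "p \<in> poly_funs N"
    and coord: "\<And>j. j < N \<Longrightarrow> bideg_poly N' r u w 1 1 (\<lambda>x. \<pi> x $ j)"
  shows "\<exists>m l. bideg_poly N' r u w m l (\<lambda>x. p (\<pi> x))"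
  using assms(1)
proof induction
  case (const c)
  show ?case by (intro exI bideg_poly_const)
next
  case (coord i)
  then show ?case using assms(2) by blast
next
  case (add p q)
  then obtain m l m' l' where "bideg_poly N' r u w m l (\<lambda>x. p (\<pi> x))"
    "bideg_poly N' r u w m' l' (\<lambda>x. q (\<pi> x))" by blast
  then have "bideg_poly N' r u w (max m m') (max l l') (\<lambda>x. p (\<pi> x) + q (\<pi> x))"
    by (intro bideg_poly.add) (auto elim: bideg_poly.weaken)
  then show ?case by blast
next
  case (mult p q)
  then obtain m l m' l' where "bideg_poly N' r u w m l (\<lambda>x. p (\<pi> x))"
    "bideg_poly N' r u w m' l' (\<lambda>x. q (\<pi> x))" by blast
  from bideg_poly.mult[OF this] show ?case by blast
qed

definition bimonomial ::
  "nat \<Rightarrow> nat \<Rightarrow> (nat \<Rightarrow> 'a \<Rightarrow> complex) \<Rightarrow> (nat \<Rightarrow> 'a \<Rightarrow> complex) \<Rightarrow> (nat \<Rightarrow> nat) \<Rightarrow> (nat \<Rightarrow> nat) \<Rightarrow> 'a \<Rightarrow> complex"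
  where "bimonomial N r u w b a x = (\<Prod>j<N. u j x ^ b j) * (\<Prod>i<r. w i x ^ a i)"

lemma prod_power_fun_upd:
  fixes g :: "nat \<Rightarrow> complex"
  assumes "j < N"
  shows "(\<Prod>i<N. g i ^ (b(j := b j + e)) i) = g j ^ e * (\<Prod>i<N. g i ^ b i)"
proof -
  have "(\<Prod>i<N. g i ^ (b(j := b j + e)) i)
      = g j ^ (b j + e) * (\<Prod>i\<in>{..<N} - {j}. g i ^ (b(j := b j + e)) i)"
    using assms by (subst prod.remove[of _ j]) auto
  also have "(\<Prod>i\<in>{..<N} - {j}. g i ^ (b(j := b j + e)) i) = (\<Prod>i\<in>{..<N} - {j}. g i ^ b i)"
    by (intro prod.cong) auto
  also have "g j ^ (b j + e) * \<dots> = g j ^ e * (g j ^ b j * \<dots>)"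
    by (simp add: power_add mult_ac)
  also have "g j ^ b j * (\<Prod>i\<in>{..<N} - {j}. g i ^ b i) = (\<Prod>i<N. g i ^ b i)"
    using assms by (subst (2) prod.remove[of _ j]) auto
  finally show ?thesis .
qed

lemma sum_fun_upd_add:
  fixes b :: "nat \<Rightarrow> nat"
  assumes "j < N"
  shows "(\<Sum>i<N. (b(j := b j + e)) i) = e + (\<Sum>i<N. b i)"
proof -
  have "(\<Sum>i<N. (b(j := b j + e)) i) = (b j + e) + (\<Sum>i\<in>{..<N} - {j}. (b(j := b j + e)) i)"
    using assms by (subst sum.remove[of _ j]) auto
  also have "(\<Sum>i\<in>{..<N} - {j}. (b(j := b j + e)) i) = (\<Sum>i\<in>{..<N} - {j}. b i)"
    by (intro sum.cong) auto
  also have "(b j + e) + \<dots> = e + (b j + \<dots>)" by simp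
  also have "b j + (\<Sum>i\<in>{..<N} - {j}. b i) = (\<Sum>i<N. b i)"
    using assms by (subst (2) sum.remove[of _ j]) auto
  finally show ?thesis .
qed

lemma bideg_poly_bimonomial:
  "bideg_poly N r u w ((\<Sum>j<N. b j) + (\<Sum>i<r. a i)) (\<Sum>i<r. a i) (bimonomial N r u w b a)"
proof -
  have "bideg_poly N r u w (\<Sum>j<N. b j * 1) (\<Sum>j<N. b j * 0) (\<lambda>x. \<Prod>j<N. u j x ^ b j)"
    by (intro bideg_poly_prod bideg_poly_power bideg_poly.gen_u) simp
  moreover have "bideg_poly N r u w (\<Sum>i<r. a i * 1) (\<Sum>i<r. a i * 1) (\<lambda>x. \<Prod>i<r. w i x ^ a i)"
    by (intro bideg_poly_prod bideg_poly_power bideg_poly.gen_w) simp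
  ultimately have "bideg_poly N r u w ((\<Sum>j<N. b j * 1) + (\<Sum>i<r. a i * 1))
      ((\<Sum>j<N. b j * 0) + (\<Sum>i<r. a i * 1))
      (\<lambda>x. (\<Prod>j<N. u j x ^ b j) * (\<Prod>i<r. w i x ^ a i))"
    by (rule bideg_poly.mult)
  then show ?thesis by (simp add: bimonomial_def[abs_def])
qed

text \<open>
  Membership of a polynomial in a linear space \<open>V\<close> of functions may be tested on monomials. The
  induction carries an additional monomial factor and lets \<open>V\<close> vary: for a product \<open>f * g\<close> the
  hypothesis for \<open>g\<close> is applied to the linear space of all \<open>h\<close> with \<open>f * h\<close> in \<open>V\<close>.
\<close>

lemma bideg_poly_in_linear_closure:
  assumes "bideg_poly N r u w m l f"
    and "\<And>c g. V g \<Longrightarrow> V (\<lambda>x. c * g x)"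
    and "\<And>g h. V g \<Longrightarrow> V h \<Longrightarrow> V (\<lambda>x. g x + h x)"
    and "\<And>b a. (\<Sum>i<r. a i) \<le> l \<Longrightarrow> (\<Sum>j<N. b j) + (\<Sum>i<r. a i) \<le> m \<Longrightarrow> V (bimonomial N r u w b a)"
  shows "V f"
proof -
  have "V (\<lambda>x. f x * bimonomial N r u w b a x)"
    if "bideg_poly N r u w m l f"
      and "\<And>c g. V g \<Longrightarrow> V (\<lambda>x. c * g x)"
      and "\<And>g h. V g \<Longrightarrow> V h \<Longrightarrow> V (\<lambda>x. g x + h x)"
      and "\<And>b a. (\<Sum>i<r. a i) \<le> l + l0 \<Longrightarrow> (\<Sum>j<N. b j) + (\<Sum>i<r. a i) \<le> m + m0
             \<Longrightarrow> V (bimonomial N r u w b a)"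
      and "(\<Sum>i<r. a i) \<le> l0" and "(\<Sum>j<N. b j) + (\<Sum>i<r. a i) \<le> m0"
    for V m0 l0 b a f m l
    using that
  proof (induction arbitrary: V m0 l0 b a rule: bideg_poly.induct)
    case (const c)
    then show ?case by simp
  next
    case (gen_u j)
    have "(\<lambda>x. u j x * bimonomial N r u w b a x) = bimonomial N r u w (b(j := b j + 1)) a"
      using prod_power_fun_upd[OF gen_u.hyps, of "\<lambda>i. u i x" b 1 for x]
      by (auto simp: bimonomial_def fun_eq_iff simp del: fun_upd_apply)
    moreover have "V (bimonomial N r u w (b(j := b j + 1)) a)"
      using gen_u sum_fun_upd_add[OF gen_u.hyps, of b 1]
      by (intro gen_u.prems(3)) (auto simp del: fun_upd_apply)
    ultimately show ?case by simp
  next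
    case (gen_w i)
    have "(\<lambda>x. w i x * bimonomial N r u w b a x) = bimonomial N r u w b (a(i := a i + 1))"
      using prod_power_fun_upd[OF gen_w.hyps, of "\<lambda>j. w j x" a 1 for x]
      by (auto simp: bimonomial_def fun_eq_iff simp del: fun_upd_apply)
    moreover have "V (bimonomial N r u w b (a(i := a i + 1)))"
      using gen_w sum_fun_upd_add[OF gen_w.hyps, of a 1]
      by (intro gen_w.prems(3)) (auto simp del: fun_upd_apply)
    ultimately show ?case by simp
  next
    case (add m l f g)
    have "V (\<lambda>x. f x * bimonomial N r u w b a x)"
      by (rule add.IH(1)[of V l0 m0]) (use add.prems in blast)+
    moreover have "V (\<lambda>x. g x * bimonomial N r u w b a x)"
      by (rule add.IH(2)[of V l0 m0]) (use add.prems in blast)+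
    ultimately have "V (\<lambda>x. f x * bimonomial N r u w b a x + g x * bimonomial N r u w b a x)"
      by (rule add.prems(2))
    then show ?case by (simp add: distrib_right)
  next
    case (mult m l f m' l' g)
    have "V (\<lambda>x. f x * (g x * bimonomial N r u w b a x))"
    proof (rule mult.IH(2)[of "\<lambda>h. V (\<lambda>x. f x * h x)" l0 m0])
      show "V (\<lambda>x. f x * (c * h x))" if "V (\<lambda>x. f x * h x)" for c h
        using mult.prems(1)[OF that, of c] by (simp add: mult_ac)
      show "V (\<lambda>x. f x * (h x + h' x))" if "V (\<lambda>x. f x * h x)" "V (\<lambda>x. f x * h' x)" for h h'
        using mult.prems(2)[OF that] by (simp add: distrib_left)
      show "V (\<lambda>x. f x * bimonomial N r u w b' a' x)"
        if "(\<Sum>i<r. a' i) \<le> l' + l0" "(\<Sum>j<N. b' j) + (\<Sum>i<r. a' i) \<le> m' + m0" for b' a'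
        by (rule mult.IH(1)[of V "l' + l0" "m' + m0"])
           (use mult.prems that in \<open>simp_all add: add.assoc\<close>)
    qed (use mult.prems in auto)
    then show ?case by (simp add: mult.assoc)
  next
    case (weaken m l f m' l')
    show ?case
    proof (rule weaken.IH[of V l0 m0])
      show "V (bimonomial N r u w b a)"
        if "(\<Sum>i<r. a i) \<le> l + l0" "(\<Sum>j<N. b j) + (\<Sum>i<r. a i) \<le> m + m0" for b a
        using that weaken.hyps by (intro weaken.prems(3)) auto
    qed (use weaken.prems in auto)
  qed
  from this[OF assms(1), of V 0 0 "\<lambda>_. 0" "\<lambda>_. 0"] assms(2-4)
  show ?thesis by (simp add: bimonomial_def)
qed

section \<open>Bounding the number of independent functions\<close>

text \<open>
  Exponents of monomials whose degree in each \<open>w i\<close> is below \<open>e\<close>; the box \<open>{..s}\<close> for the exponents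
  of the \<open>u j\<close> is a convenient superset of those of degree at most \<open>s\<close>.
\<close>

definition reduced_exponents :: "nat \<Rightarrow> nat \<Rightarrow> nat \<Rightarrow> nat \<Rightarrow> ((nat \<Rightarrow> nat) \<times> (nat \<Rightarrow> nat)) set" where
  "reduced_exponents N r e s = PiE {..<N} (\<lambda>_. {..s}) \<times> PiE {..<r} (\<lambda>_. {..<e})"

lemma finite_reduced_exponents: "finite (reduced_exponents N r e s)"
  by (simp add: reduced_exponents_def finite_PiE)

lemma card_reduced_exponents: "card (reduced_exponents N r e s) = (s + 1) ^ N * e ^ r"
  by (simp add: reduced_exponents_def card_cartesian_product card_PiE)

text \<open>
  If on \<open>X\<close> each power \<open>w i ^ Suc e\<close> equals a polynomial of the same total degree but of lower degree
  in the \<open>w\<close> variables, then every monomial containing such a power can be rewritten. This is the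
  explicit form of the statement that the functions on \<open>X\<close> are a finite module over the polynomials in
  the \<open>u j\<close>, with control of the degree.
\<close>

lemma reduced_bimonomials_span:
  assumes red: "\<And>i. i < r \<Longrightarrow>
      \<exists>g. bideg_poly N r u w (Suc e) e g \<and> (\<forall>x\<in>X. w i x ^ Suc e = g x)"
    and f: "bideg_poly N r u w s l f"
  shows "\<exists>c. \<forall>x\<in>X. f x = (\<Sum>p\<in>reduced_exponents N r (Suc e) s.
              c p * bimonomial N r u w (fst p) (snd p) x)"
proof -
  let ?E = "reduced_exponents N r (Suc e) s"
  let ?mon = "\<lambda>p. bimonomial N r u w (fst p) (snd p)"
  define V where "V f \<longleftrightarrow> (\<exists>c. \<forall>x\<in>X. f x = (\<Sum>p\<in>?E. c p * ?mon p x))" for f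
  have V_scale: "V (\<lambda>x. c * g x)" if "V g" for c g
  proof -
    from that obtain b where "\<forall>x\<in>X. g x = (\<Sum>p\<in>?E. b p * ?mon p x)" unfolding V_def by blast
    then have "\<forall>x\<in>X. c * g x = (\<Sum>p\<in>?E. (c * b p) * ?mon p x)"
      by (simp add: sum_distrib_left mult.assoc)
    then show ?thesis unfolding V_def by (intro exI[of _ "\<lambda>p. c * b p"])
  qed
  have V_add: "V (\<lambda>x. g x + h x)" if gh: "V g" "V h" for g h
  proof -
    from gh obtain b c where "\<forall>x\<in>X. g x = (\<Sum>p\<in>?E. b p * ?mon p x)"
      and "\<forall>x\<in>X. h x = (\<Sum>p\<in>?E. c p * ?mon p x)" unfolding V_def by blast
    then have "\<forall>x\<in>X. g x + h x = (\<Sum>p\<in>?E. (b p + c p) * ?mon p x)"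
      by (simp add: sum.distrib distrib_right)
    then show ?thesis unfolding V_def by (intro exI[of _ "\<lambda>p. b p + c p"])
  qed
  have V_cong: "V g" if "V h" "\<And>x. x \<in> X \<Longrightarrow> g x = h x" for g h
    using that unfolding V_def by auto
  have V_reduced: "V (bimonomial N r u w b a)"
    if b: "(\<Sum>j<N. b j) \<le> s" and a: "\<And>i. i < r \<Longrightarrow> a i \<le> e" for b a
  proof -
    define p where "p = (restrict b {..<N}, restrict a {..<r})"
    have "b j \<le> s" if "j < N" for j
      using member_le_sum[of j "{..<N}" b] b that by simp
    then have p: "p \<in> ?E"
      using a by (auto simp: p_def reduced_exponents_def less_Suc_eq_le)
    have "bimonomial N r u w b a x = (\<Sum>q\<in>?E. (if q = p then 1 else 0) * ?mon q x)" for x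
    proof -
      have "(\<Sum>q\<in>?E. (if q = p then 1 else 0) * ?mon q x) = (\<Sum>q\<in>?E. if q = p then ?mon q x else 0)"
        by (intro sum.cong) auto
      also have "\<dots> = ?mon p x" using p by (simp add: finite_reduced_exponents)
      also have "\<dots> = bimonomial N r u w b a x" by (simp add: bimonomial_def p_def)
      finally show ?thesis by simp
    qed
    then show ?thesis unfolding V_def by (intro exI[of _ "\<lambda>q. if q = p then 1 else 0"]) blast
  qed
  have "bideg_poly N r u w s l f \<Longrightarrow> V f" for l f
  proof (induction l arbitrary: f rule: less_induct)
    case (less l)
    show ?case
    proof (rule bideg_poly_in_linear_closure[OF less.prems V_scale V_add])
      fix b a :: "nat \<Rightarrow> nat"
      assume deg_w: "(\<Sum>i<r. a i) \<le> l" and deg: "(\<Sum>j<N. b j) + (\<Sum>i<r. a i) \<le> s"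
      show "V (bimonomial N r u w b a)"
      proof (cases "\<forall>i<r. a i \<le> e")
        case True
        then show ?thesis using deg by (intro V_reduced) auto
      next
        case False
        then obtain i where i: "i < r" "Suc e \<le> a i" by auto
        define a' where "a' = a(i := a i - Suc e)"
        have a_eq: "a = a'(i := a' i + Suc e)" using i by (auto simp: a'_def)
        have sum_a: "(\<Sum>i<r. a i) = Suc e + (\<Sum>i<r. a' i)"
          by (subst a_eq, rule sum_fun_upd_add[OF i(1)])
        have split: "bimonomial N r u w b a x = w i x ^ Suc e * bimonomial N r u w b a' x" for x
          unfolding bimonomial_def
          by (subst a_eq, subst prod_power_fun_upd[OF i(1)]) (simp only: mult_ac)
        from red[OF i(1)] obtain g where g: "bideg_poly N r u w (Suc e) e g"
          and wg: "\<And>x. x \<in> X \<Longrightarrow> w i x ^ Suc e = g x" by blast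
        have "bideg_poly N r u w (Suc e + ((\<Sum>j<N. b j) + (\<Sum>i<r. a' i))) (e + (\<Sum>i<r. a' i))
            (\<lambda>x. g x * bimonomial N r u w b a' x)"
          by (rule bideg_poly.mult[OF g bideg_poly_bimonomial])
        then have "bideg_poly N r u w s (l - 1) (\<lambda>x. g x * bimonomial N r u w b a' x)"
          by (rule bideg_poly.weaken) (use sum_a deg_w deg in simp_all)
        then have "V (\<lambda>x. g x * bimonomial N r u w b a' x)"
          by (rule less.IH[rotated]) (use sum_a deg_w in simp)
        then show ?thesis by (rule V_cong) (simp only: split wg)
      qed
    qed
  qed
  from this[OF f] show ?thesis unfolding V_def .
qed

text \<open>
  Compare growth rates. The monomials in \<open>f 0, \<dots>, f (K - 1)\<close> with exponents at most \<open>t\<close> form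
  \<open>(t + 1) ^ K\<close> linearly independent functions on \<open>X\<close>, whose degree is linear in \<open>t\<close>; reduced monomials
  span a space of dimension \<open>O(t ^ N)\<close> that contains them all.
\<close>

lemma card_independent_family_le:
  assumes red: "\<And>i. i < r \<Longrightarrow>
      \<exists>g. bideg_poly N r u w (Suc e) e g \<and> (\<forall>x\<in>X. w i x ^ Suc e = g x)"
    and f: "\<And>i. i < K \<Longrightarrow> \<exists>m l. bideg_poly N r u w m l (f i)"
    and indep: "\<And>t c a. \<forall>x\<in>X. (\<Sum>a\<in>PiE {..<K} (\<lambda>_. {..t}). c a * (\<Prod>i<K. f i x ^ a i)) = 0
      \<Longrightarrow> a \<in> PiE {..<K} (\<lambda>_. {..t}) \<Longrightarrow> c a = 0"
  shows "K \<le> N"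
proof (rule ccontr)
  assume "\<not> K \<le> N"
  then have K: "Suc N \<le> K" by simp
  have "\<forall>i. \<exists>m l. i < K \<longrightarrow> bideg_poly N r u w m l (f i)" using f by blast
  then obtain m l where ml: "\<And>i. i < K \<Longrightarrow> bideg_poly N r u w (m i) (l i) (f i)"
    unfolding choice_iff by blast
  define D where "D = (\<Sum>i<K. m i)"
  \<comment> \<open>Chosen so that \<open>(D * t + 1) ^ N * Suc e ^ r < (t + 1) ^ Suc N\<close>.\<close>
  define t where "t = (D + 1) ^ N * Suc e ^ r"
  let ?A = "PiE {..<K} (\<lambda>_. {..t})"
  let ?E = "reduced_exponents N r (Suc e) (D * t)"
  let ?mon = "\<lambda>p. bimonomial N r u w (fst p) (snd p)"
  have "\<exists>c. \<forall>x\<in>X. (\<Prod>i<K. f i x ^ a i) = (\<Sum>p\<in>?E. c p * ?mon p x)" if a: "a \<in> ?A" for a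
  proof -
    have "bideg_poly N r u w (\<Sum>i<K. a i * m i) (\<Sum>i<K. a i * l i) (\<lambda>x. \<Prod>i<K. f i x ^ a i)"
      using ml by (intro bideg_poly_prod bideg_poly_power) simp
    moreover have "(\<Sum>i<K. a i * m i) \<le> D * t"
      unfolding D_def sum_distrib_right
      using a by (intro sum_mono) (auto simp: PiE_def Pi_def mult.commute)
    ultimately have "bideg_poly N r u w (D * t) (\<Sum>i<K. a i * l i) (\<lambda>x. \<Prod>i<K. f i x ^ a i)"
      by (rule bideg_poly.weaken) simp
    from reduced_bimonomials_span[OF red this] show ?thesis by blast
  qed
  then have "\<exists>C. \<forall>a\<in>?A. \<forall>x\<in>X. (\<Prod>i<K. f i x ^ a i) = (\<Sum>p\<in>?E. C a p * ?mon p x)"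
    by (intro bchoice ballI)
  then obtain C where C: "\<And>a x. a \<in> ?A \<Longrightarrow> x \<in> X \<Longrightarrow>
      (\<Prod>i<K. f i x ^ a i) = (\<Sum>p\<in>?E. C a p * ?mon p x)"
    by blast
  have "card ?E = (D * t + 1) ^ N * Suc e ^ r" by (rule card_reduced_exponents)
  also have "\<dots> \<le> ((D + 1) * (t + 1)) ^ N * Suc e ^ r"
    by (intro mult_right_mono power_mono) simp_all
  also have "\<dots> = (t + 1) ^ N * t" by (simp only: t_def power_mult_distrib mult_ac)
  also have "\<dots> < (t + 1) ^ N * (t + 1)" by (intro mult_strict_left_mono) simp_all
  also have "\<dots> = (t + 1) ^ Suc N" by simp
  also have "\<dots> \<le> (t + 1) ^ K" using K by (intro power_increasing) auto
  also have "\<dots> = card ?A" by (simp add: card_PiE)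
  finally have "card ?E < card ?A" .
  from underdetermined_system_nontrivial_solution[OF _ _ this, of C]
  obtain c where c: "\<exists>a\<in>?A. c a \<noteq> 0" "\<And>p. p \<in> ?E \<Longrightarrow> (\<Sum>a\<in>?A. c a * C a p) = 0"
    by (auto simp: finite_reduced_exponents finite_PiE)
  have "\<forall>x\<in>X. (\<Sum>a\<in>?A. c a * (\<Prod>i<K. f i x ^ a i)) = 0"
  proof
    fix x assume x: "x \<in> X"
    have "(\<Sum>a\<in>?A. c a * (\<Prod>i<K. f i x ^ a i)) = (\<Sum>a\<in>?A. \<Sum>p\<in>?E. c a * C a p * ?mon p x)"
      using x by (intro sum.cong refl) (simp add: C sum_distrib_left mult.assoc)
    also have "\<dots> = (\<Sum>p\<in>?E. (\<Sum>a\<in>?A. c a * C a p) * ?mon p x)"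
      by (subst sum.swap) (simp add: sum_distrib_right)
    also have "\<dots> = 0" using c(2) by simp
    finally show "(\<Sum>a\<in>?A. c a * (\<Prod>i<K. f i x ^ a i)) = 0" .
  qed
  with indep c(1) show False by blast
qed

section \<open>The form of a tensor and its differential\<close>

lemma finite_multi_indices: "finite (multi_indices N d)"
  using finite_lists_length_eq[of "{..<N}" d] by (simp add: multi_indices_def conj_commute)

lemma multi_indices_nth_less:
  assumes "js \<in> multi_indices N d" "k < d"
  shows "js ! k < N"
proof -
  have "js ! k \<in> set js" "set js \<subseteq> {..<N}" using assms by (simp_all add: multi_indices_def)
  then show ?thesis by blast
qed

lemma prod_sum_multi_indices:
  fixes g :: "nat \<Rightarrow> nat \<Rightarrow> complex"
  shows "(\<Prod>k<d. \<Sum>j<N. g k j) = (\<Sum>js\<in>multi_indices N d. \<Prod>k<d. g k (js ! k))"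
proof -
  have "(\<Prod>k<d. \<Sum>j<N. g k j) = (\<Sum>h\<in>PiE {..<d} (\<lambda>_. {..<N}). \<Prod>k<d. g k (h k))"
    by (rule prod_sum_PiE) auto
  also have "\<dots> = (\<Sum>js\<in>multi_indices N d. \<Prod>k<d. g k (js ! k))"
  proof (rule sum.reindex_bij_witness
      [where i = "\<lambda>js. restrict (nth js) {..<d}" and j = "\<lambda>h. map h [0..<d]"])
    fix h assume h: "h \<in> PiE {..<d} (\<lambda>_. {..<N})"
    show "restrict (nth (map h [0..<d])) {..<d} = h"
    proof
      fix k
      show "restrict (nth (map h [0..<d])) {..<d} k = h k"
        using h by (cases "k < d") (auto simp: PiE_def extensional_def)
    qed
    show "map h [0..<d] \<in> multi_indices N d"
      using h by (auto simp: multi_indices_def PiE_def Pi_def)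
    show "(\<Prod>k<d. g k (map h [0..<d] ! k)) = (\<Prod>k<d. g k (h k))"
      by (intro prod.cong) auto
  next
    fix js assume js: "js \<in> multi_indices N d"
    show "map (restrict (nth js) {..<d}) [0..<d] = js"
      using js by (intro nth_equalityI) (auto simp: multi_indices_def)
    show "restrict (nth js) {..<d} \<in> PiE {..<d} (\<lambda>_. {..<N})"
      using multi_indices_nth_less[OF js] by auto
  qed
  finally show ?thesis .
qed

text \<open>
  The form of \<open>A \<cdot> T\<close> is the form of \<open>T\<close> composed with the transpose of \<open>A\<close>, and the form of the
  identity tensor is a power sum. Only the first \<open>r\<close> coordinates are substituted, that is, the equality
  is stated on the span of the first \<open>r\<close> basis vectors.
\<close>

lemma power_sum_of_action_eq_identity:
  fixes w :: "nat \<Rightarrow> complex"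
  assumes A: "A \<in> carrier_mat N N" and r: "r \<le> N"
    and act: "tensor_act N d A T = identity_tensor N d r"
  shows "(\<Sum>js\<in>multi_indices N d. T js * (\<Prod>k<d. \<Sum>i<r. A $$ (i, js ! k) * w i)) = (\<Sum>i<r. w i ^ d)"
proof -
  let ?M = "multi_indices N d"
  define y where "y i = (if i < r then w i else 0)" for i
  have elem: "elem_tensor N (map (\<lambda>i. A *\<^sub>v unit_vec N i) is) js = (\<Prod>k<d. A $$ (js ! k, is ! k))"
    if "is \<in> ?M" "js \<in> ?M" for "is" js
  proof -
    have len: "length is = d" using that(1) by (simp add: multi_indices_def)
    show ?thesis
      using A that len multi_indices_nth_less[OF that(1)] multi_indices_nth_less[OF that(2)]
      by (auto simp: elem_tensor_def intro!: prod.cong)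
  qed
  have unit: "elem_tensor N (replicate d (unit_vec N i)) js = (\<Prod>k<d. if js ! k = i then 1 else 0)"
    if "i < r" "js \<in> ?M" for i js
    using that r multi_indices_nth_less[OF that(2)]
    by (auto simp: elem_tensor_def intro!: prod.cong)
  have inner: "(\<Sum>i<r. A $$ (i, l) * w i) = (\<Sum>j<N. A $$ (j, l) * y j)" for l
  proof -
    have "(\<Sum>j<N. A $$ (j, l) * y j) = (\<Sum>j<r. A $$ (j, l) * y j)"
      using r by (intro sum.mono_neutral_right) (auto simp: y_def)
    then show ?thesis by (simp add: y_def)
  qed
  have "(\<Sum>is\<in>?M. T is * (\<Prod>k<d. \<Sum>i<r. A $$ (i, is ! k) * w i))
      = (\<Sum>is\<in>?M. T is * (\<Prod>k<d. \<Sum>j<N. A $$ (j, is ! k) * y j))"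
    by (simp only: inner)
  also have "\<dots> = (\<Sum>is\<in>?M. T is * (\<Sum>js\<in>?M. (\<Prod>k<d. A $$ (js ! k, is ! k)) * (\<Prod>k<d. y (js ! k))))"
    by (simp only: prod_sum_multi_indices prod.distrib)
  also have "\<dots> = (\<Sum>is\<in>?M. \<Sum>js\<in>?M. T is * (\<Prod>k<d. A $$ (js ! k, is ! k)) * (\<Prod>k<d. y (js ! k)))"
    by (simp only: sum_distrib_left mult.assoc)
  also have "\<dots> = (\<Sum>js\<in>?M. \<Sum>is\<in>?M. T is * (\<Prod>k<d. A $$ (js ! k, is ! k)) * (\<Prod>k<d. y (js ! k)))"
    by (rule sum.swap)
  also have "\<dots> = (\<Sum>js\<in>?M. tensor_act N d A T js * (\<Prod>k<d. y (js ! k)))"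
    unfolding tensor_act_def sum_distrib_right by (intro sum.cong refl) (simp add: elem)
  also have "\<dots> = (\<Sum>js\<in>?M. (\<Sum>i<r. \<Prod>k<d. if js ! k = i then 1 else 0) * (\<Prod>k<d. y (js ! k)))"
    unfolding act identity_tensor_def by (intro sum.cong refl arg_cong2[of _ _ _ _ "(*)"]) (simp add: unit)
  also have "\<dots> = (\<Sum>js\<in>?M. \<Sum>i<r. \<Prod>k<d. (if js ! k = i then 1 else 0) * y (js ! k))"
    by (simp only: sum_distrib_right prod.distrib)
  also have "\<dots> = (\<Sum>i<r. \<Sum>js\<in>?M. \<Prod>k<d. (if js ! k = i then 1 else 0) * y (js ! k))"
    by (rule sum.swap)
  also have "\<dots> = (\<Sum>i<r. \<Prod>k<d. \<Sum>j<N. (if j = i then 1 else 0) * y j)"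
    by (simp only: prod_sum_multi_indices)
  also have "\<dots> = (\<Sum>i<r. w i ^ d)"
  proof (intro sum.cong refl)
    fix i assume i: "i \<in> {..<r}"
    have "(\<Sum>j<N. (if j = i then 1 else 0) * y j) = (\<Sum>j<N. if j = i then y j else 0)"
      by (intro sum.cong) auto
    also have "\<dots> = w i" using i r by (simp add: y_def)
    finally show "(\<Prod>k<d. \<Sum>j<N. (if j = i then 1 else 0) * y j) = w i ^ d" by simp
  qed
  finally show ?thesis .
qed

text \<open>
  The differential at \<open>x\<close>, in the direction \<open>v\<close>, of the homogeneous form with coefficients \<open>T\<close>. Points
  are coordinate functions rather than vectors, so that sums of directions need no dimension side
  conditions.
\<close>

definition form_differential ::
  "nat \<Rightarrow> nat \<Rightarrow> tensor \<Rightarrow> (nat \<Rightarrow> complex) \<Rightarrow> (nat \<Rightarrow> complex) \<Rightarrow> complex" where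
  "form_differential N d T x v =
     (\<Sum>js\<in>multi_indices N d. T js * (\<Sum>l<d. v (js ! l) * (\<Prod>k\<in>{..<d} - {l}. x (js ! k))))"

lemma has_field_derivative_form_differential:
  "((\<lambda>t. \<Sum>js\<in>multi_indices N d. T js * (\<Prod>k<d. x (js ! k) + t * v (js ! k)))
    has_field_derivative form_differential N d T x v) (at 0)"
proof -
  have "((\<lambda>t. \<Prod>k<d. x (js ! k) + t * v (js ! k)) has_field_derivative
      (\<Sum>l<d. v (js ! l) * (\<Prod>k\<in>{..<d} - {l}. x (js ! k) + 0 * v (js ! k)))) (at 0)" for js
    by (rule has_field_derivative_prod) (auto intro!: derivative_eq_intros)
  then show ?thesis
    unfolding form_differential_def by (intro DERIV_sum DERIV_cmult) simp
qed

lemma form_differential_cong: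
  assumes "\<And>j. j < N \<Longrightarrow> v j = v' j"
  shows "form_differential N d T x v = form_differential N d T x v'"
  unfolding form_differential_def
  using assms multi_indices_nth_less
  by (intro sum.cong refl arg_cong2[of _ _ _ _ "(*)"]) auto

lemma form_differential_sum:
  "form_differential N d T x (\<lambda>l. \<Sum>j\<in>J. c j * v j l) = (\<Sum>j\<in>J. c j * form_differential N d T x (v j))"
proof -
  have "(\<Sum>l<d. (\<Sum>j\<in>J. c j * v j (js ! l)) * (\<Prod>k\<in>{..<d} - {l}. x (js ! k)))
      = (\<Sum>j\<in>J. c j * (\<Sum>l<d. v j (js ! l) * (\<Prod>k\<in>{..<d} - {l}. x (js ! k))))" for js
    unfolding sum_distrib_right sum_distrib_left
    by (subst sum.swap) (simp only: mult.assoc)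
  then have "form_differential N d T x (\<lambda>l. \<Sum>j\<in>J. c j * v j l)
      = (\<Sum>js\<in>multi_indices N d. \<Sum>j\<in>J.
          c j * (T js * (\<Sum>l<d. v j (js ! l) * (\<Prod>k\<in>{..<d} - {l}. x (js ! k)))))"
    unfolding form_differential_def by (simp only: sum_distrib_left mult.left_commute)
  also have "\<dots> = (\<Sum>j\<in>J. c j * form_differential N d T x (v j))"
    unfolding form_differential_def sum_distrib_left by (rule sum.swap)
  finally show ?thesis .
qed

lemma partial_deriv_assoc_poly:
  assumes x: "x \<in> carrier_vec N" and i: "i < N"
  shows "partial_deriv N i (assoc_poly N d T) x
    = form_differential N d T (\<lambda>j. x $ j) (\<lambda>j. if j = i then 1 else 0)"
proof -
  have "assoc_poly N d T (x + t \<cdot>\<^sub>v unit_vec N i)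
      = (\<Sum>js\<in>multi_indices N d. T js * (\<Prod>k<d. x $ (js ! k) + t * (if js ! k = i then 1 else 0)))" for t
    unfolding assoc_poly_def
    using x i multi_indices_nth_less
    by (intro sum.cong refl arg_cong2[of _ _ _ _ "(*)"] prod.cong) auto
  then show ?thesis
    unfolding partial_deriv_def
    using DERIV_imp_deriv[OF has_field_derivative_form_differential
        [where N = N and d = d and T = T and x = "\<lambda>j. x $ j" and v = "\<lambda>j. if j = i then 1 else 0"]]
    by simp
qed

lemma form_differential_critical:
  assumes x: "x \<in> carrier_vec N"
    and crit: "\<forall>i<N. partial_deriv N i (assoc_poly N d T) x = 0"
  shows "form_differential N d T (\<lambda>j. x $ j) v = 0"
proof -
  have "form_differential N d T (\<lambda>j. x $ j) v
      = form_differential N d T (\<lambda>j. x $ j) (\<lambda>l. \<Sum>i<N. v i * (if l = i then 1 else 0))"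
    by (rule form_differential_cong) (simp add: mult_if_delta if_distrib[of "(*) _"] cong: if_cong)
  also have "\<dots> = (\<Sum>i<N. v i * partial_deriv N i (assoc_poly N d T) x)"
    unfolding form_differential_sum
    by (intro sum.cong refl) (simp add: partial_deriv_assoc_poly[OF x])
  also have "\<dots> = 0" using crit by simp
  finally show ?thesis .
qed

text \<open>
  If the linear substitution with columns \<open>b i\<close> turns the form into a power sum, the chain rule
  expresses \<open>w i ^ (d - 1)\<close> through the differential of the form. This replaces a use of the
  Nullstellensatz: at a critical point in the span of the \<open>b i\<close> all
  \<open>w i\<close> are zero, and the exponent \<open>d - 1\<close> is explicit.
\<close>

lemma form_differential_power_sum:
  fixes r :: nat and b :: "nat \<Rightarrow> nat \<Rightarrow> complex"
  assumes F: "\<And>w. (\<Sum>js\<in>multi_indices N d. T js * (\<Prod>k<d. \<Sum>i<r. b i (js ! k) * w i)) = (\<Sum>i<r. w i ^ d)"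
    and i: "i < r"
  shows "form_differential N d T (\<lambda>j. \<Sum>i<r. b i j * w i) (b i) = of_nat d * w i ^ (d - 1)"
proof -
  have lin: "(\<Sum>i'<r. b i' j * (w(i := w i + t)) i') = (\<Sum>i'<r. b i' j * w i') + t * b i j" for t j
  proof -
    have "(\<Sum>i'<r. b i' j * (w(i := w i + t)) i')
        = (\<Sum>i'<r. b i' j * w i' + (if i' = i then t * b i j else 0))"
      by (intro sum.cong) (auto simp: algebra_simps)
    also have "\<dots> = (\<Sum>i'<r. b i' j * w i') + (\<Sum>i'<r. if i' = i then t * b i j else 0)"
      by (rule sum.distrib)
    also have "(\<Sum>i'<r. if i' = i then t * b i j else 0) = t * b i j"
      using i by (subst sum.delta) auto
    finally show ?thesis .
  qed
  have "(\<lambda>t. \<Sum>i'<r. (w(i := w i + t)) i' ^ d)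
      = (\<lambda>t. \<Sum>js\<in>multi_indices N d. T js * (\<Prod>k<d. (\<Sum>i'<r. b i' (js ! k) * w i') + t * b i (js ! k)))"
    by (simp only: F[symmetric] lin)
  then have "((\<lambda>t. \<Sum>i'<r. (w(i := w i + t)) i' ^ d) has_field_derivative
      form_differential N d T (\<lambda>j. \<Sum>i<r. b i j * w i) (b i)) (at 0)"
    using has_field_derivative_form_differential
        [where N = N and d = d and T = T and x = "\<lambda>j. \<Sum>i<r. b i j * w i" and v = "b i"] by simp
  moreover have "((\<lambda>t. \<Sum>i'<r. (w(i := w i + t)) i' ^ d) has_field_derivative
      (\<Sum>i'<r. if i' = i then of_nat d * w i ^ (d - 1) else 0)) (at 0)"
    by (rule DERIV_sum) (auto intro!: derivative_eq_intros)
  ultimately have "form_differential N d T (\<lambda>j. \<Sum>i<r. b i j * w i) (b i)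
      = (\<Sum>i'<r. if i' = i then of_nat d * w i ^ (d - 1) else 0)"
    by (rule DERIV_unique)
  then show ?thesis using i by simp
qed

section \<open>Polynomial functions on irreducible closed sets\<close>

lemma irreducible_closed_mult_eq_zero:
  assumes irr: "irreducible_closed N S" and p: "p \<in> poly_funs N" and q: "q \<in> poly_funs N"
    and pq: "\<forall>x\<in>S. p x * q x = 0"
  shows "(\<forall>x\<in>S. p x = 0) \<or> (\<forall>x\<in>S. q x = 0)"
proof -
  from irr obtain P where P: "P \<subseteq> poly_funs N" and S: "S = {x \<in> carrier_vec N. \<forall>p\<in>P. p x = 0}"
    unfolding irreducible_closed_def zariski_closed_def by blast
  have closed: "zariski_closed N {x \<in> S. f x = 0}" if "f \<in> poly_funs N" for f
    unfolding zariski_closed_def using P S that by (intro exI[of _ "insert f P"]) auto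
  have "S = {x \<in> S. p x = 0} \<union> {x \<in> S. q x = 0}" using pq by auto
  then have "S = {x \<in> S. p x = 0} \<or> S = {x \<in> S. q x = 0}"
    using irr closed[OF p] closed[OF q] unfolding irreducible_closed_def by blast
  then show ?thesis by blast
qed

lemma zariski_closed_separating_poly:
  assumes "zariski_closed N S" "x \<in> carrier_vec N" "x \<notin> S"
  shows "\<exists>p\<in>poly_funs N. (\<forall>y\<in>S. p y = 0) \<and> p x \<noteq> 0"
  using assms unfolding zariski_closed_def by blast

section \<open>Chains in the critical locus and the subrank bound\<close>

text \<open>
  Let \<open>Y = C k\<close> be the top of the chain and let \<open>b i\<close> be the rows of \<open>A\<close>. On \<open>Y \<times> \<complex>\<^sup>r\<close> consider
  \<open>u(p, v) = p - \<Sum> v i \<bullet> b i\<close> and the coordinates \<open>w i = v i\<close>. The functions that separate consecutive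
  members of the chain, together with the \<open>w i\<close>, are \<open>k + r\<close> algebraically independent functions. Since
  the differential of the form vanishes at \<open>p\<close>, while at \<open>p - u\<close> it is \<open>d * w i ^ (d - 1)\<close> in the
  direction \<open>b i\<close>, the power \<open>w i ^ (d - 1)\<close> is a combination of monomials that contain some \<open>u j\<close>.
  Hence at most \<open>N\<close> functions are independent.
\<close>

lemma critical_chain_length_bound:
  fixes C :: "nat \<Rightarrow> complex vec set"
  assumes d: "2 \<le> d" and A: "A \<in> carrier_mat N N" and r: "r \<le> N"
    and act: "tensor_act N d A T = identity_tensor N d r"
    and irr: "\<And>i. i \<le> k \<Longrightarrow> irreducible_closed N (C i)"
    and crit: "C k \<subseteq> {x \<in> carrier_vec N. \<forall>i<N. partial_deriv N i (assoc_poly N d T) x = 0}"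
    and strict: "\<And>i. i < k \<Longrightarrow> C i \<subset> C (Suc i)"
  shows "k + r \<le> N"
proof -
  define b where "b i j = A $$ (i, j)" for i j
  define u :: "nat \<Rightarrow> complex vec \<times> (nat \<Rightarrow> complex) \<Rightarrow> complex"
    where "u j x = fst x $ j - (\<Sum>i<r. b i j * snd x i)" for j x
  define w :: "nat \<Rightarrow> complex vec \<times> (nat \<Rightarrow> complex) \<Rightarrow> complex"
    where "w i x = snd x i" for i x
  \<comment> \<open>The flag \<open>C 0 \<times> {0}, \<dots>, C k \<times> {0}\<close> is continued by \<open>C k \<times> \<complex>\<^sup>1, \<dots>, C k \<times> \<complex>\<^sup>r\<close>, where \<open>\<complex>\<^sup>j\<close> is
      the set of sequences that vanish from index \<open>j\<close> on.\<close>
  define X :: "nat \<Rightarrow> (complex vec \<times> (nat \<Rightarrow> complex)) set"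
    where "X i = {(p, v). p \<in> C (min i k) \<and> (\<forall>j. i \<le> k + j \<longrightarrow> v j = 0)}" for i
  let ?B = "bideg_poly N r u w"

  have C_carrier: "C i \<subseteq> carrier_vec N" if "i \<le> k" for i
    using irr[OF that] unfolding irreducible_closed_def zariski_closed_def by blast
  have "\<exists>p\<in>poly_funs N. (\<forall>y\<in>C i. p y = 0) \<and> (\<exists>x\<in>C (Suc i). p x \<noteq> 0)" if "i < k" for i
  proof -
    from strict[OF that] obtain x where x: "x \<in> C (Suc i)" "x \<notin> C i" by blast
    moreover have "x \<in> carrier_vec N" using x(1) C_carrier[of "Suc i"] that by auto
    moreover have "zariski_closed N (C i)"
      using irr[of i] that by (simp add: irreducible_closed_def)
    ultimately show ?thesis using zariski_closed_separating_poly by blast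
  qed
  then have "\<forall>i\<in>{..<k}. \<exists>p. p \<in> poly_funs N \<and> (\<forall>y\<in>C i. p y = 0) \<and> (\<exists>x\<in>C (Suc i). p x \<noteq> 0)"
    by blast
  then obtain \<phi> where \<phi>_all:
    "\<forall>i\<in>{..<k}. \<phi> i \<in> poly_funs N \<and> (\<forall>y\<in>C i. \<phi> i y = 0) \<and> (\<exists>x\<in>C (Suc i). \<phi> i x \<noteq> 0)"
    by atomize_elim (rule bchoice)
  then have \<phi>: "\<And>i. i < k \<Longrightarrow> \<phi> i \<in> poly_funs N"
    "\<And>i y. i < k \<Longrightarrow> y \<in> C i \<Longrightarrow> \<phi> i y = 0"
    "\<And>i. i < k \<Longrightarrow> \<exists>x\<in>C (Suc i). \<phi> i x \<noteq> 0"
    by blast+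
  \<comment> \<open>\<open>f i\<close> is zero on \<open>X i\<close>; past the chain it is the coordinate that is freed in \<open>X (Suc i)\<close>.\<close>
  define f where "f i x = (if i < k then \<phi> i (fst x) else w (i - k) x)" for i x

  have coord: "?B 1 1 (\<lambda>x. fst x $ j)" if "j < N" for j
  proof -
    have "?B 1 1 (\<lambda>x. u j x + (\<Sum>i<r. b i j * w i x))"
      using that by (intro bideg_poly.add bideg_poly_sum bideg_poly_scale)
        (auto intro: bideg_poly.gen_w[unfolded One_nat_def] bideg_poly.weaken[OF bideg_poly.gen_u])
    then show ?thesis by (simp add: u_def w_def)
  qed

  show ?thesis
  proof (rule card_independent_family_le[where X = "X (k + r)" and f = f and u = u and w = w
        and e = "d - 2" and r = r])
    fix i assume i: "i < r"
    define \<beta> where "\<beta> j x = (\<Sum>i<r. b i j * w i x)" for j x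
    define g where "g x = - (1 / of_nat d) *
        (form_differential N d T (\<lambda>j. fst x $ j) (b i) - form_differential N d T (\<lambda>j. \<beta> j x) (b i))" for x
    have \<beta>: "?B 1 1 (\<beta> j)" for j
      unfolding \<beta>_def by (intro bideg_poly_sum bideg_poly_scale) (auto intro: bideg_poly.gen_w[unfolded One_nat_def])
    have "?B (d - 1) (d - 2) (\<lambda>x. (\<Prod>k\<in>{..<d} - {l}. fst x $ (js ! k)) - (\<Prod>k\<in>{..<d} - {l}. \<beta> (js ! k) x))"
      if js: "js \<in> multi_indices N d" and l: "l < d" for js l
    proof -
      have "?B (card ({..<d} - {l})) (card ({..<d} - {l}) - 1)
          (\<lambda>x. (\<Prod>k\<in>{..<d} - {l}. u (js ! k) x + \<beta> (js ! k) x) - (\<Prod>k\<in>{..<d} - {l}. \<beta> (js ! k) x))"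
      proof (rule bideg_poly_prod_add_minus_prod)
        have "card ({..<d} - {l}) \<noteq> 0" using d l by simp
        then show "{..<d} - {l} \<noteq> {}" by (metis card.empty)
      qed (use js \<beta> in \<open>auto intro: bideg_poly.gen_u[unfolded One_nat_def] multi_indices_nth_less\<close>)
      moreover have "u j x + \<beta> j x = fst x $ j" for j x by (simp add: u_def \<beta>_def w_def)
      moreover have "card ({..<d} - {l}) = d - 1" using l by simp
      moreover have "d - 1 - 1 = d - 2" by simp
      ultimately show ?thesis by simp
    qed
    then have "?B (d - 1) (d - 2) (\<lambda>x. - (1 / of_nat d) *
        (\<Sum>js\<in>multi_indices N d. T js * (\<Sum>l<d. b i (js ! l) *
          ((\<Prod>k\<in>{..<d} - {l}. fst x $ (js ! k)) - (\<Prod>k\<in>{..<d} - {l}. \<beta> (js ! k) x)))))"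
      by (intro bideg_poly_sum bideg_poly_scale) auto
    then have "?B (d - 1) (d - 2) g"
      unfolding g_def[abs_def] form_differential_def
      by (simp only: right_diff_distrib sum_subtractf)
    moreover have "w i x ^ (d - 1) = g x" if "x \<in> X (k + r)" for x
    proof -
      have "fst x \<in> C k" using that by (auto simp: X_def)
      then have "fst x \<in> carrier_vec N" "\<forall>i<N. partial_deriv N i (assoc_poly N d T) (fst x) = 0"
        using crit by auto
      then have "form_differential N d T (\<lambda>j. fst x $ j) (b i) = 0"
        by (rule form_differential_critical)
      \<comment> \<open>The point \<open>\<beta>\<close> lies on the linear space on which the form is a power sum.\<close>
      moreover have "form_differential N d T (\<lambda>j. \<beta> j x) (b i) = of_nat d * w i x ^ (d - 1)"
        unfolding \<beta>_def
        by (rule form_differential_power_sum[OF _ i])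
           (unfold b_def, rule power_sum_of_action_eq_identity[OF A r act])
      ultimately show ?thesis using d by (simp add: g_def)
    qed
    moreover have "Suc (d - 2) = d - 1" using d by simp
    ultimately show "\<exists>g. ?B (Suc (d - 2)) (d - 2) g \<and> (\<forall>x\<in>X (k + r). w i x ^ Suc (d - 2) = g x)"
      by auto
  next
    fix i assume i: "i < k + r"
    show "\<exists>m l. ?B m l (f i)"
    proof (cases "i < k")
      case True
      have "\<exists>m l. ?B m l (\<lambda>x. \<phi> i (fst x))"
        by (rule poly_funs_bideg_poly[OF \<phi>(1)[OF True] coord])
      then show ?thesis using True by (simp add: f_def[abs_def])
    next
      case False
      have "?B 1 1 (w (i - k))" using i False by (intro bideg_poly.gen_w) simp
      then show ?thesis using False by (auto simp add: f_def[abs_def])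
    qed
  next
    fix t c a
    assume zero: "\<forall>x\<in>X (k + r). (\<Sum>a\<in>PiE {..<k + r} (\<lambda>_. {..t}). c a * (\<Prod>i<k + r. f i x ^ a i)) = 0"
      and a: "a \<in> PiE {..<k + r} (\<lambda>_. {..t})"
    \<comment> \<open>Polynomiality on \<open>\<complex>\<^sup>N \<times> {0}\<close> allows cancellation of a separating function on an irreducible
        set; continuity along coordinate lines allows cancellation of a coordinate \<open>w j\<close>.\<close>
    define \<P> :: "(complex vec \<times> (nat \<Rightarrow> complex) \<Rightarrow> complex) set"
      where "\<P> = {q. (\<lambda>p. q (p, \<lambda>_. 0)) \<in> poly_funs N \<and> (\<forall>p v j. isCont (\<lambda>t. q (p, v(j := t))) 0)}"
    show "c a = 0"
    proof (rule monomials_independent_along_flag[where X = X and f = f and \<P> = \<P> and K = "k + r",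
          OF _ _ _ _ _ _ _ _ zero a])
      show "(\<lambda>_. c) \<in> \<P>" for c
        by (simp add: \<P>_def poly_funs.const)
      show "(\<lambda>x. p x + q x) \<in> \<P>" if "p \<in> \<P>" "q \<in> \<P>" for p q
        using that by (simp add: \<P>_def poly_funs.add)
      show "(\<lambda>x. p x * q x) \<in> \<P>" if "p \<in> \<P>" "q \<in> \<P>" for p q
        using that by (simp add: \<P>_def poly_funs.mult)
      show "f i \<in> \<P>" for i
      proof (cases "i < k")
        case True
        then show ?thesis using \<phi>(1) by (simp add: \<P>_def f_def)
      next
        case False
        have "isCont (\<lambda>t. (v(j := t)) (i - k)) 0" for v :: "nat \<Rightarrow> complex" and j
          by (cases "j = i - k") simp_all
        then show ?thesis using False by (simp add: \<P>_def f_def w_def poly_funs.const)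
      qed
      have "C 0 \<noteq> {}" using irr[of 0] by (simp add: irreducible_closed_def)
      then show "X 0 \<noteq> {}" by (auto simp: X_def)
      show "X i \<subseteq> X (Suc i)" if "i < k + r" for i
      proof -
        have "C (min i k) \<subseteq> C (min (Suc i) k)"
          using strict[of i] by (cases "i < k") (auto simp: min_def)
        then show ?thesis by (auto simp: X_def)
      qed
      show "f i x = 0" if "x \<in> X i" for i x
        using that \<phi>(2)[of i] by (auto simp: X_def f_def w_def min_def)
      show "\<forall>x\<in>X (Suc i). q x = 0"
        if q: "q \<in> \<P>" and fq: "\<forall>x\<in>X (Suc i). f i x * q x = 0" for i q
      proof (cases "i < k")
        case True
        have X_eq: "X (Suc i) = {(p, v). p \<in> C (Suc i) \<and> v = (\<lambda>_. 0)}"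
          using True by (auto simp: X_def min_def fun_eq_iff)
        have "\<forall>p\<in>C (Suc i). \<phi> i p * q (p, \<lambda>_. 0) = 0"
          using fq True by (auto simp: X_eq f_def)
        then have "(\<forall>p\<in>C (Suc i). \<phi> i p = 0) \<or> (\<forall>p\<in>C (Suc i). q (p, \<lambda>_. 0) = 0)"
          using q True irr by (intro irreducible_closed_mult_eq_zero[of N] \<phi>(1)) (auto simp: \<P>_def)
        then show ?thesis using \<phi>(3)[OF True] by (auto simp: X_eq)
      next
        case False
        define j where "j = i - k"
        have i: "i = k + j" using False by (simp add: j_def)
        show ?thesis
        proof
          fix x assume x: "x \<in> X (Suc i)"
          obtain p v where pv: "x = (p, v)" by (cases x)
          \<comment> \<open>A function that vanishes where \<open>w j \<noteq> 0\<close> vanishes at \<open>w j = 0\<close> too, by continuity.\<close>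
          have line: "(p, v(j := t)) \<in> X (Suc i)" for t
            using x by (auto simp: X_def pv i)
          have off: "q (p, v(j := t)) = 0" if "t \<noteq> 0" for t
            using fq line[of t] that by (auto simp: f_def w_def i)
          have "(\<lambda>t. q (p, v(j := t))) \<midarrow>0\<rightarrow> q (p, v(j := 0))"
            using q by (auto simp: \<P>_def isCont_def)
          moreover have "(\<lambda>t. q (p, v(j := t))) \<midarrow>0\<rightarrow> 0"
            by (rule Lim_transform_eventually[OF tendsto_const])
               (auto simp: eventually_at_filter off)
          ultimately have "q (p, v(j := 0)) = 0" by (rule LIM_unique)
          then have "q (p, v(j := v j)) = 0" using off[of "v j"] by (cases "v j = 0") simp_all
          then show "q x = 0" by (simp add: pv)
        qed
      qed
    qed
  qed
qed

lemma identity_tensor_action_zero: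
  assumes "0 < d"
  shows "tensor_act N d (0\<^sub>m N N) T = identity_tensor N d 0"
proof
  fix js
  have "elem_tensor N (map (\<lambda>i. 0\<^sub>m N N *\<^sub>v unit_vec N i) is) js = 0" if "is \<in> multi_indices N d" for "is"
  proof -
    have "length is = d" using that by (simp add: multi_indices_def)
    moreover have "js ! 0 < N" if "js \<in> multi_indices N d"
      using multi_indices_nth_less[OF that assms] .
    ultimately show ?thesis
      using assms multi_indices_nth_less[OF \<open>is \<in> _\<close> assms]
      by (auto simp: elem_tensor_def intro!: bexI[of _ 0])
  qed
  then show "tensor_act N d (0\<^sub>m N N) T js = identity_tensor N d 0 js"
    by (simp add: tensor_act_def identity_tensor_def)
qed

theorem theorem3p7:
  fixes n d :: nat and T :: tensor
  assumes "d \<ge> 2"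
    and "T \<in> sym_tensors (n + 1) d"
  shows "enat (sym_subrank (n + 1) d T) \<le> sym_geometric_rank (n + 1) d T"
proof -
  let ?N = "n + 1"
  let ?Z = "{x \<in> carrier_vec ?N. \<forall>i<?N. partial_deriv ?N i (assoc_poly ?N d T) x = 0}"
  let ?R = "{r. r \<le> ?N \<and> (\<exists>A \<in> carrier_mat ?N ?N. tensor_act ?N d A T = identity_tensor ?N d r)}"
  define r where "r = sym_subrank ?N d T"
  \<comment> \<open>The maximum that defines the subrank is attained.\<close>
  have "0 \<in> ?R" using identity_tensor_action_zero[of d ?N T] assms(1) by auto
  moreover have "finite ?R" by simp
  ultimately have "r \<in> ?R" unfolding r_def sym_subrank_def using Max_in by blast
  then obtain A where A: "A \<in> carrier_mat ?N ?N" "tensor_act ?N d A T = identity_tensor ?N d r"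
    and r: "r \<le> ?N" by blast
  have "zariski_dim ?N ?Z \<le> enat (?N - r)"
    unfolding zariski_dim_def
  proof (rule Sup_least)
    fix z
    assume "z \<in> {enat k | k. \<exists>C. (\<forall>i\<le>k. irreducible_closed ?N (C i) \<and> C i \<subseteq> ?Z) \<and>
                                (\<forall>i<k. C i \<subset> C (Suc i))}"
    then obtain k C where z: "z = enat k" and C: "\<forall>i\<le>k. irreducible_closed ?N (C i) \<and> C i \<subseteq> ?Z"
      "\<forall>i<k. C i \<subset> C (Suc i)" by blast
    have "k + r \<le> ?N"
      by (rule critical_chain_length_bound[OF assms(1) A(1) r A(2), where C = C]) (use C in blast)+
    then show "z \<le> enat (?N - r)" by (simp add: z)
  qed
  then have "enat ?N - enat (?N - r) \<le> zariski_codim ?N ?Z"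
    unfolding zariski_codim_def by (cases "zariski_dim ?N ?Z") auto
  then show ?thesis
    using r by (simp add: sym_geometric_rank_def r_def)
qed

end
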